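(* The family of finite groups without nontrivial cyclic coprime direct factors is cyclic bounded; that is, for every natural number $n$ there are, up to isomorphism, only finitely many finite groups $G$ such that $G$ has no nontrivial cyclic coprime direct factor and $c(G)\leqslant n$.
   Context: For a finite group $G$, $c(G)$ denotes the number of cyclic subgroups of $G$ (including the trivial one). A group $H$ is a coprime direct factor of a finite group $G$ if $G$ is isomorphic to a direct product $H\times K$ for some group $K$ such that $|H|$ and $|K|$ are coprime ($K$ is allowed to be trivial, so a group is a coprime direct factor of itself). A family $\mathscr{F}$ of finite groups is called cyclic bounded (CB) if, for every natural number $n$, there are only finitely many groups $G$ in $\mathscr{F}$ up to isomorphism with $c(G)\leqslant n$. *)

theory Defs
  imports "HOL-Algebra.Algebra"
begin

definition num_cyclic_subgroups :: "'a monoid \<Rightarrow> nat" where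
  "num_cyclic_subgroups G =
     card {C. subgroup C G \<and> cyclic_group (G\<lparr>carrier := C\<rparr>)}"

text \<open>
  HOL cannot quantify over types inside a definition, so the complement \<open>K\<close> ranges over groups
  with carrier in \<^typ>\<open>nat\<close>. Every finite group is isomorphic to such a group, and \<open>K\<close> is
  necessarily finite when \<open>G\<close> is, so for finite \<open>G\<close> this is no restriction. The same applies to
  \<open>H\<close> in \<open>finite_groups_without_cyclic_cdf\<close> below.
\<close>

definition coprime_direct_factor :: "'b monoid \<Rightarrow> 'a monoid \<Rightarrow> bool" where
  "coprime_direct_factor H G \<longleftrightarrow> group H \<and>
     (\<exists>K :: nat monoid. group K \<and> G \<cong> (H \<times>\<times> K) \<and> coprime (order H) (order K))"

text \<open>
  ``Finitely many up to isomorphism'' means that finitely many members \<open>S\<close> of the family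
  represent all isomorphism classes of its members \<open>G\<close> with at most \<open>n\<close> cyclic subgroups.
\<close>

definition cyclic_bounded :: "'a monoid set \<Rightarrow> bool" where
  "cyclic_bounded F \<longleftrightarrow> (\<forall>G\<in>F. group G \<and> finite (carrier G)) \<and>
     (\<forall>n :: nat. \<exists>S. finite S \<and> S \<subseteq> {G \<in> F. num_cyclic_subgroups G \<le> n} \<and>
        (\<forall>G\<in>F. num_cyclic_subgroups G \<le> n \<longrightarrow> (\<exists>H\<in>S. G \<cong> H)))"

text \<open>
  The carrier type is a parameter; the instance \<open>'a = nat\<close> contains a copy of every finite group.
\<close>

definition finite_groups_without_cyclic_cdf :: "'a monoid set" where
  "finite_groups_without_cyclic_cdf =
     {G. group G \<and> finite (carrier G) \<and>
         \<not> (\<exists>H :: nat monoid. coprime_direct_factor H G \<and> cyclic_group H \<and> \<not> trivial_group H)}"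

end

theory Submission
  imports Defs
begin

text \<open>
  Let \<open>p\<close> be a prime dividing the order of \<open>G\<close> and exceeding \<open>c(G)\<close>. A Sylow \<open>p\<close>-subgroup \<open>P\<close> is a union of
  fewer than \<open>p\<close> cyclic subgroups; were these all proper, they would have at most \<open>|P| / p\<close> elements
  each, so \<open>P\<close> is cyclic. A \<open>p\<close>-element permutes the cyclic subgroups of \<open>G\<close> in orbits of size less than
  \<open>p\<close>, so it normalizes all of them. Hence every \<open>p\<close>-element normalizes \<open>P\<close> and lies in \<open>P\<close>, so \<open>P\<close> is
  normal; and for a \<open>p'\<close>-element \<open>y\<close> the commutators of \<open>y\<close> with \<open>P\<close> lie in \<open>P \<inter> \<langle>y\<rangle> = 1\<close>. Therefore \<open>P\<close> is
  central, and the transfer into \<open>P\<close> splits it off: \<open>G \<cong> P \<times> G/P\<close>, so \<open>P\<close> is a nontrivial cyclic coprime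
  direct factor.

  For \<open>G\<close> in the family with \<open>c(G) \<le> n\<close>, all prime divisors of its order are thus at most \<open>n\<close>. If \<open>p\<^sup>k\<close>
  divides the order of \<open>x\<close>, then \<open>x\<close> already has \<open>k + 1\<close> powers \<open>x, x\<^sup>p, \<dots>\<close> generating distinct subgroups,
  so \<open>k < n\<close>. Element orders therefore divide \<open>(n!)\<^sup>n\<close>, and \<open>G\<close>, a union of at most \<open>n\<close> cyclic subgroups, has order
  at most \<open>n (n!)\<^sup>n\<close>.
\<close>

section \<open>Coprime powers and the count of cyclic subgroups\<close>

text \<open>By Bezout, \<open>x\<close> is a product of powers of \<open>x [^] a\<close> and
  \<open>x [^] b\<close>. With \<open>H\<close> a stabilizer, a centralizer, a Sylow subgroup or the
  trivial group, this is the main way in which coprimality enters below.\<close>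

lemma (in group) mem_subgroup_if_coprime_powers_mem:
  fixes a b :: nat
  assumes H: "subgroup H G" and x: "x \<in> carrier G"
    and a: "x [^] a \<in> H" and b: "x [^] b \<in> H" and ab: "coprime a b"
  shows "x \<in> H"
proof -
  obtain u v where uv: "u * int a + v * int b = 1"
    using bezout_int[of "int a" "int b"] ab by auto
  have "x = x [^] (int a * u + int b * v)"
    using uv x by (simp add: mult.commute)
  also have "\<dots> = (x [^] a) [^] u \<otimes> (x [^] b) [^] v"
    using x by (simp add: int_pow_mult flip: int_pow_pow int_pow_int)
  also have "\<dots> \<in> H"
    using H a b by (simp add: subgroup.m_closed subgroup_int_pow_closed)
  finally show ?thesis .
qed

text \<open>Indexing by generators makes the family an image of the carrier, so its finiteness and
  comparisons with other such images are immediate.\<close>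

lemma (in group) cyclic_subgroups_eq:
  "{C. subgroup C G \<and> cyclic_group (G\<lparr>carrier := C\<rparr>)} = (\<lambda>x. generate G {x}) ` carrier G"
proof (intro equalityI subsetI)
  fix C assume "C \<in> {C. subgroup C G \<and> cyclic_group (G\<lparr>carrier := C\<rparr>)}"
  then have C: "subgroup C G" and "cyclic_group (G\<lparr>carrier := C\<rparr>)"
    by auto
  then obtain x where x: "x \<in> C" "subgroup_generated (G\<lparr>carrier := C\<rparr>) {x} = G\<lparr>carrier := C\<rparr>"
    by (auto simp: cyclic_group_def)
  have "C = carrier (subgroup_generated (G\<lparr>carrier := C\<rparr>) {x})"
    unfolding x(2) by simp
  also have "\<dots> = generate G {x}"
    using x(1) C generate_consistent[of "{x}" C] by (simp add: carrier_subgroup_generated)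
  finally show "C \<in> (\<lambda>x. generate G {x}) ` carrier G"
    using x C subgroup.mem_carrier by fastforce
next
  fix C assume "C \<in> (\<lambda>x. generate G {x}) ` carrier G"
  then obtain x where x: "x \<in> carrier G" "C = generate G {x}" by auto
  then have "subgroup C G" by (simp add: generate_is_subgroup)
  moreover have "G\<lparr>carrier := C\<rparr> = subgroup_generated G {x}"
    using x by (simp add: subgroup_generated_def)
  ultimately show "C \<in> {C. subgroup C G \<and> cyclic_group (G\<lparr>carrier := C\<rparr>)}"
    by (simp add: cyclic_group_generated)
qed

text \<open>
  Unlike \<^const>\<open>num_cyclic_subgroups\<close>, the following also applies to the extended records
  \<^typ>\<open>('a, 'b) monoid_scheme\<close> of the locale \<^locale>\<open>group\<close>.
\<close>

definition card_cyclic_subgroups :: "('a, 'b) monoid_scheme \<Rightarrow> nat" where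
  "card_cyclic_subgroups G = card ((\<lambda>x. generate G {x}) ` carrier G)"

lemma num_cyclic_subgroups_eq:
  "group G \<Longrightarrow> num_cyclic_subgroups G = card_cyclic_subgroups G"
  by (simp add: num_cyclic_subgroups_def card_cyclic_subgroups_def group.cyclic_subgroups_eq)

lemma (in group) generate_singleton_subset:
  assumes "subgroup H G" "x \<in> H"
  shows "generate G {x} \<subseteq> H"
  using assms by (simp add: generate_subgroup_incl)

text \<open>\<open>H\<close> is the union of the cyclic subgroups generated by its elements, each of
  size at most \<open>k\<close>. These are among the cyclic subgroups of \<open>G\<close>.\<close>

lemma (in group) card_cyclic_decomposition_le:
  assumes fin: "finite (carrier G)" and H: "subgroup H G"
    and le: "\<And>x. x \<in> H \<Longrightarrow> card (generate G {x}) \<le> k"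
  shows "card H \<le> card_cyclic_subgroups G * k"
proof -
  let ?S = "(\<lambda>x. generate G {x}) ` H"
  have Hc: "H \<subseteq> carrier G" using H by (rule subgroup.subset)
  have finH: "finite H" using fin Hc finite_subset by blast
  have "H \<subseteq> \<Union> ?S" by (auto intro: generate.incl)
  moreover have "\<Union> ?S \<subseteq> H" using generate_singleton_subset[OF H] by blast
  ultimately have "card H = card (\<Union> ?S)" by simp
  also have "\<dots> \<le> (\<Sum>C\<in>?S. card C)"
    by (rule card_Union_le_sum_card)
  also have "\<dots> \<le> card ?S * k"
    using sum_bounded_above[of ?S card k] le by auto
  also have "\<dots> \<le> card_cyclic_subgroups G * k"
    unfolding card_cyclic_subgroups_def using fin Hc
    by (intro mult_right_mono card_mono) auto
  finally show ?thesis .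
qed

lemma (in group) card_subgroup_dvd:
  assumes "subgroup H G" "subgroup K G" "H \<subseteq> K"
  shows "card H dvd card K"
proof -
  have "subgroup H (G\<lparr>carrier := K\<rparr>)"
    using assms by (simp add: subgroup_incl)
  from group.lagrange[OF subgroup_imp_group[OF assms(2)] this]
  have "card (rcosets\<^bsub>G\<lparr>carrier := K\<rparr>\<^esub> H) * card H = card K"
    by (simp add: order_def)
  then show ?thesis by (metis dvd_triv_right)
qed

section \<open>Primes exceeding the number of cyclic subgroups\<close>

text \<open>If no element generated \<open>P\<close>, every cyclic subgroup of \<open>P\<close>
  would have order at most \<open>p ^ (a - 1)\<close>, and fewer than \<open>p\<close> of them
  cannot cover \<open>P\<close>.\<close>

lemma (in group) p_subgroup_cyclic:
  assumes fin: "finite (carrier G)" and p: "Factorial_Ring.prime p" and less: "card_cyclic_subgroups G < p"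
    and P: "subgroup P G" and card: "card P = p ^ a"
  shows "\<exists>x\<in>P. P = generate G {x}"
proof (rule ccontr)
  assume neg: "\<not> ?thesis"
  have finP: "finite P" using fin P finite_subset subgroup.subset by blast
  have dvd: "\<exists>i<a. card (generate G {x}) = p ^ i" if x: "x \<in> P" for x
  proof -
    have sub: "generate G {x} \<subseteq> P" using P x by (rule generate_singleton_subset)
    have "subgroup (generate G {x}) G"
      using x P by (simp add: generate_is_subgroup subgroup.mem_carrier)
    then have "card (generate G {x}) dvd p ^ a"
      using card_subgroup_dvd[OF _ P sub] card by simp
    then obtain i where i: "i \<le> a" "card (generate G {x}) = p ^ i"
      using p divides_primepow_nat by blast
    moreover have "i \<noteq> a"
      using neg x sub card i(2) card_subset_eq[OF finP sub] by metis
    ultimately show ?thesis by (metis le_neq_implies_less)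
  qed
  \<comment> \<open>The subgroup generated by the identity also has order \<open>p ^ i\<close> with
    \<open>i < a\<close>, which rules out \<open>a = 0\<close>.\<close>
  have "a > 0" using dvd[OF subgroup.one_closed[OF P]] by auto
  then obtain b where b: "a = Suc b" by (cases a) auto
  have "card P \<le> card_cyclic_subgroups G * p ^ b"
  proof (rule card_cyclic_decomposition_le[OF fin P])
    fix x assume "x \<in> P"
    then obtain i where "i < a" "card (generate G {x}) = p ^ i" using dvd by auto
    then show "card (generate G {x}) \<le> p ^ b"
      using b prime_ge_1_nat[OF p] by (simp add: power_increasing)
  qed
  also have "\<dots> < p * p ^ b" using less p by (simp add: prime_gt_0_nat)
  finally show False using card b by simp
qed

text \<open>By pigeonhole some power \<open>z [^] d\<close> with \<open>0 < d < p\<close> fixes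
  \<open>x\<close>. Since \<open>z [^] (p ^ a)\<close> is the identity and \<open>d\<close> is
  coprime to \<open>p ^ a\<close>, \<open>z\<close> itself fixes \<open>x\<close>.\<close>

lemma (in group_action) p_element_in_stabilizer:
  assumes x: "x \<in> E" and z: "z \<in> carrier G" and p: "Factorial_Ring.prime p" and zp: "z [^] (p ^ a) = \<one>"
    and fin: "finite (orbit G \<phi> x)" and less: "card (orbit G \<phi> x) < p"
  shows "z \<in> stabilizer G \<phi> x"
proof -
  interpret G: group G using group_hom group_hom.axioms(1) by blast
  let ?n = "card (orbit G \<phi> x)"
  let ?f = "\<lambda>i::nat. \<phi> (z [^] i) x"
  \<comment> \<open>The exponents \<open>0, ..., ?n\<close> are one more in number than the points
    of the orbit, so two of them collide.\<close>
  have "?f ` {..?n} \<subseteq> orbit G \<phi> x" using z by (auto simp: orbit_def)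
  then have "card (?f ` {..?n}) \<le> ?n" using fin card_mono by blast
  then have "\<not> inj_on ?f {..?n}" by (auto dest!: card_image)
  then obtain k l where kl: "k \<le> ?n" "l \<le> ?n" "k \<noteq> l" "?f k = ?f l"
    by (auto simp: inj_on_def)
  obtain i j where ij: "i < j" "j \<le> ?n" "?f i = ?f j"
  proof (cases "k < l")
    case True
    then show thesis using that kl by blast
  next
    case False
    then show thesis using that[of l k] kl by simp
  qed
  define d where "d = j - i"
  have d: "d > 0" "d < p" "j = i + d" using ij less by (auto simp: d_def)
  have "\<phi> (z [^] i) (\<phi> (z [^] d) x) = \<phi> (z [^] i) x"
    using ij(3) d(3) z x composition_rule[of x "z [^] i" "z [^] d"] by (simp add: G.nat_pow_mult)
  moreover have "\<phi> (z [^] d) x \<in> E" using x z element_image[of "z [^] d"] by simp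
  ultimately have "\<phi> (z [^] d) x = x"
    using inj_onD[OF inj_prop[of "z [^] i"]] x z by simp
  then have "z [^] d \<in> stabilizer G \<phi> x" using z by (simp add: stabilizer_def)
  moreover have "z [^] (p ^ a) \<in> stabilizer G \<phi> x"
    using zp stabilizer_subgroup[OF x] subgroup.one_closed by metis
  moreover have "coprime d (p ^ a)"
    using d p by (metis coprime_commute coprime_power_right_iff nat_dvd_not_less prime_imp_coprime)
  ultimately show ?thesis
    using G.mem_subgroup_if_coprime_powers_mem stabilizer_subgroup[OF x] z by metis
qed

text \<open>Conjugation by \<open>g\<close> is an endomorphism, hence maps a generated subgroup to
  the one generated by the image. This keeps conjugation orbits of cyclic subgroups among the cyclic
  subgroups.\<close>

lemma (in group) conj_generate_singleton:
  assumes g: "g \<in> carrier G" and y: "y \<in> carrier G"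
  shows "g <# generate G {y} #> inv g = generate G {g \<otimes> y \<otimes> inv g}"
proof -
  have "(\<lambda>u. g \<otimes> u \<otimes> inv g) \<in> hom G G"
    using g by (simp add: hom_def m_assoc inv_solve_left)
  then interpret h: group_hom G G "\<lambda>u. g \<otimes> u \<otimes> inv g"
    by unfold_locales
  have "g <# generate G {y} #> inv g = (\<lambda>u. g \<otimes> u \<otimes> inv g) ` generate G {y}"
    by (auto simp: l_coset_def r_coset_def)
  also have "\<dots> = generate G ((\<lambda>u. g \<otimes> u \<otimes> inv g) ` {y})"
    using h.generate_img[of "{y}"] y by simp
  finally show ?thesis by simp
qed

text \<open>The conjugates of a cyclic subgroup are cyclic, so its orbit has fewer than
  \<open>p\<close> members and a \<open>p\<close>-element must fix it.\<close>

lemma (in group) p_element_normalizes_cyclic: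
  assumes fin: "finite (carrier G)" and p: "Factorial_Ring.prime p" and less: "card_cyclic_subgroups G < p"
    and z: "z \<in> carrier G" and zp: "z [^] (p ^ a) = \<one>" and y: "y \<in> carrier G"
  shows "z \<in> normalizer G (generate G {y})"
proof -
  let ?\<phi> = "\<lambda>g. \<lambda>H\<in>{H. H \<subseteq> carrier G}. g <# H #> inv g"
  interpret act: group_action G "{H. H \<subseteq> carrier G}" ?\<phi>
    by (rule action_by_conjugation_on_power_set)
  let ?K = "generate G {y}"
  have K: "?K \<subseteq> carrier G" using y by (simp add: generate_incl)
  have sub: "orbit G ?\<phi> ?K \<subseteq> (\<lambda>x. generate G {x}) ` carrier G"
    using y K by (auto simp: orbit_def conj_generate_singleton)
  have finC: "finite ((\<lambda>x. generate G {x}) ` carrier G)" using fin by simp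
  have "finite (orbit G ?\<phi> ?K)" using finC sub by (rule rev_finite_subset)
  moreover have "card (orbit G ?\<phi> ?K) < p"
    using card_mono[OF finC sub] less by (simp add: card_cyclic_subgroups_def)
  ultimately show ?thesis
    unfolding normalizer_def using act.p_element_in_stabilizer[OF _ z p zp] K by auto
qed

lemma (in group) p_element_conj_cyclic:
  assumes fin: "finite (carrier G)" and p: "Factorial_Ring.prime p" and less: "card_cyclic_subgroups G < p"
    and z: "z \<in> carrier G" and zp: "z [^] (p ^ a) = \<one>" and y: "y \<in> carrier G"
  shows "z \<otimes> y \<otimes> inv z \<in> generate G {y}"
proof -
  have K: "generate G {y} \<subseteq> carrier G" using y by (simp add: generate_incl)
  have "z <# generate G {y} #> inv z = generate G {y}"
    using p_element_normalizes_cyclic[OF assms] K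
    by (simp add: normalizer_def stabilizer_def)
  moreover have "z \<otimes> y \<otimes> inv z \<in> z <# generate G {y} #> inv z"
    by (auto simp: l_coset_def r_coset_def intro: generate.incl)
  ultimately show ?thesis by simp
qed

section \<open>Splitting off a central subgroup of coprime index\<close>

text \<open>In the quotient by \<open>H\<close>, the coset of \<open>x\<close> raised to the group
  order is trivial.\<close>

lemma (in normal) pow_index_mem:
  assumes "finite (carrier G)" "x \<in> carrier G"
  shows "x [^] card (rcosets H) \<in> H"
proof -
  interpret Q: group "G Mod H" by (rule factorgroup_is_group)
  have "finite (carrier (G Mod H))" using assms by (simp add: carrier_FactGroup)
  then have "(H #> x) [^]\<^bsub>G Mod H\<^esub> order (G Mod H) = H"
    using Q.pow_order_eq_1[of "H #> x"] assms by (auto simp: carrier_FactGroup)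
  then have "H #> (x [^] card (rcosets H)) = H"
    using assms FactGroup_pow by (simp add: order_def FactGroup_def)
  then show ?thesis
    using assms rcos_self[OF _ subgroup_axioms] by (metis nat_pow_closed)
qed

lemma (in group) central_imp_normal:
  assumes P: "subgroup P G"
    and central: "\<And>z g. z \<in> P \<Longrightarrow> g \<in> carrier G \<Longrightarrow> z \<otimes> g = g \<otimes> z"
  shows "P \<lhd> G"
proof (rule normal_invI[OF P])
  fix x h assume "x \<in> carrier G" "h \<in> P"
  then have "x \<otimes> h \<otimes> inv x = h"
    using central subgroup.mem_carrier[OF P] by (metis inv_closed m_assoc r_inv r_one)
  then show "x \<otimes> h \<otimes> inv x \<in> P" using \<open>h \<in> P\<close> by simp
qed

text \<open>
  The transfer of \<open>G\<close> into a central subgroup \<open>P\<close>: with \<open>s g\<close> a chosen representative of the coset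
  \<open>P g\<close> and \<open>r g = g (s g)\<^sup>-\<^sup>1 \<in> P\<close>, it sends \<open>g\<close> to the product of \<open>r (c g)\<close> over all representatives \<open>c\<close>.
\<close>

lemma (in group) transfer_central:
  assumes P: "subgroup P G"
    and central: "\<And>z g. z \<in> P \<Longrightarrow> g \<in> carrier G \<Longrightarrow> z \<otimes> g = g \<otimes> z"
  obtains \<phi> where "\<phi> \<in> hom G (G\<lparr>carrier := P\<rparr>)"
    and "\<And>z. z \<in> P \<Longrightarrow> \<phi> z = z [^] card (rcosets P)"
proof -
  let ?A = "G\<lparr>carrier := P\<rparr>"
  have grpA: "group ?A" using P by (rule subgroup_imp_group)
  interpret A: comm_group ?A
    using grpA central subgroup.mem_carrier[OF P]
    by (intro group.group_comm_groupI) auto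
  define rep where "rep C = (SOME c. c \<in> C)" for C :: "'a set"
  have rep_in: "rep (P #> g) \<in> P #> g" if "g \<in> carrier G" for g
    unfolding rep_def using rcos_self[OF that P] by (rule someI)
  have rep_carrier: "rep C \<in> carrier G" "P #> rep C = C" if C: "C \<in> rcosets P" for C
  proof -
    obtain g where g: "g \<in> carrier G" "C = P #> g" using C by (auto simp: RCOSETS_def)
    have "rep C \<in> P #> g" using rep_in g by simp
    then show "rep C \<in> carrier G" using g P by (meson subsetD r_coset_subset_G subgroup.subset)
    show "P #> rep C = C" using \<open>rep C \<in> P #> g\<close> g P by (metis repr_independence)
  qed
  define s where "s g = rep (P #> g)" for g
  define r where "r g = g \<otimes> inv (s g)" for g
  have s_carrier: "s g \<in> carrier G" "P #> s g = P #> g" if "g \<in> carrier G" for g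
    using rep_carrier[of "P #> g"] rcosetsI[OF subgroup.subset[OF P] that] by (auto simp: s_def)
  have r_in: "r g \<in> P" if g: "g \<in> carrier G" for g
  proof -
    have "g \<in> P #> s g" using s_carrier[OF g] rcos_self[OF g P] by simp
    then obtain h where "h \<in> P" "g = h \<otimes> s g" by (auto simp: r_coset_def)
    then have "r g = h"
      using s_carrier[OF g] subgroup.mem_carrier[OF P] unfolding r_def
      by (metis g inv_solve_right)
    then show ?thesis using \<open>h \<in> P\<close> by simp
  qed
  have rs: "r g \<otimes> s g = g" if "g \<in> carrier G" for g
    using that s_carrier[OF that] by (simp add: r_def m_assoc)
  \<comment> \<open>Left multiplication by an element of \<open>P\<close> does not change the coset,
    hence not the representative \<open>s g\<close>.\<close>
  have r_mult: "r (z \<otimes> g) = z \<otimes> r g" if z: "z \<in> P" and g: "g \<in> carrier G" for z g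
  proof -
    have zc: "z \<in> carrier G" using z P subgroup.mem_carrier by metis
    have "P #> (z \<otimes> g) = P #> g"
      using z zc g P by (metis coset_join3 coset_mult_assoc is_group subgroup.rcos_const subgroup.subset)
    then show ?thesis using zc g s_carrier[OF g] by (simp add: r_def s_def m_assoc)
  qed
  define \<phi> where "\<phi> g = finprod ?A (\<lambda>C. r (rep C \<otimes> g)) (rcosets P)" for g
  \<comment> \<open>A cocycle identity: write \<open>rep C \<otimes> g\<close> as its
    \<open>P\<close>-part times the representative of \<open>C #> g\<close>, then pull the
    \<open>P\<close>-part out of \<open>r\<close>.\<close>
  have step: "r (rep C \<otimes> (g \<otimes> h)) = r (rep C \<otimes> g) \<otimes> r (rep (C #> g) \<otimes> h)"
    if C: "C \<in> rcosets P" and g: "g \<in> carrier G" and h: "h \<in> carrier G" for C g h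
  proof -
    have c: "rep C \<in> carrier G" using rep_carrier C by simp
    have "C #> g = P #> (rep C \<otimes> g)"
      using rep_carrier[OF C] g P by (metis coset_mult_assoc subgroup.subset)
    then have s: "s (rep C \<otimes> g) = rep (C #> g)" by (simp add: s_def)
    have sc: "s (rep C \<otimes> g) \<in> carrier G" using s_carrier c g by simp
    have rc: "r (rep C \<otimes> g) \<in> P" using r_in c g by simp
    have "rep C \<otimes> (g \<otimes> h) = r (rep C \<otimes> g) \<otimes> s (rep C \<otimes> g) \<otimes> h"
      using rs[of "rep C \<otimes> g"] c g h by (simp add: m_assoc)
    also have "\<dots> = r (rep C \<otimes> g) \<otimes> (s (rep C \<otimes> g) \<otimes> h)"
      using sc h subgroup.mem_carrier[OF P rc] by (simp add: m_assoc)
    finally show ?thesis using r_mult[OF rc] sc h s by simp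
  qed
  \<comment> \<open>Right translation permutes the cosets, so the shifted second factor of the
    cocycle identity still multiplies up to \<open>\<phi> h\<close>.\<close>
  have perm: "bij_betw (\<lambda>C. C #> g) (rcosets P) (rcosets P)" if g: "g \<in> carrier G" for g
  proof (rule bij_betw_byWitness[where f' = "\<lambda>C. C #> inv g"])
    have sub: "C \<subseteq> carrier G" if "C \<in> rcosets P" for C
      using subgroup.rcosets_carrier[OF P is_group that] .
    show "\<forall>C\<in>rcosets P. C #> g #> inv g = C" "\<forall>C\<in>rcosets P. C #> inv g #> g = C"
      using g sub by (auto simp: coset_mult_assoc)
    have "C #> x \<in> rcosets P" if C: "C \<in> rcosets P" and x: "x \<in> carrier G" for C x
    proof -
      have "C #> x = P #> (rep C \<otimes> x)"
        using rep_carrier[OF C] x P by (metis coset_mult_assoc subgroup.subset)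
      then show ?thesis
        using rcosetsI[OF subgroup.subset[OF P], of "rep C \<otimes> x"] rep_carrier[OF C] x by simp
    qed
    then show "(\<lambda>C. C #> g) ` (rcosets P) \<subseteq> rcosets P" "(\<lambda>C. C #> inv g) ` (rcosets P) \<subseteq> rcosets P"
      using g by auto
  qed
  have r_Pi: "(\<lambda>C. r (rep C \<otimes> g)) \<in> rcosets P \<rightarrow> P" if "g \<in> carrier G" for g
    using that r_in rep_carrier by auto
  have "\<phi> \<in> hom G ?A"
  proof (rule homI)
    fix g assume "g \<in> carrier G"
    then show "\<phi> g \<in> carrier ?A" unfolding \<phi>_def using r_Pi by (intro A.finprod_closed) simp
  next
    fix g h assume g: "g \<in> carrier G" and h: "h \<in> carrier G"
    have shift: "(\<lambda>C. r (rep (C #> g) \<otimes> h)) \<in> rcosets P \<rightarrow> P"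
      using r_Pi[OF h] bij_betw_apply[OF perm[OF g]] by (auto simp: Pi_iff)
    have "\<phi> (g \<otimes> h) = finprod ?A (\<lambda>C. r (rep C \<otimes> g) \<otimes>\<^bsub>?A\<^esub> r (rep (C #> g) \<otimes> h)) (rcosets P)"
      unfolding \<phi>_def using r_Pi[OF g] shift step g h
      by (intro A.finprod_cong') (auto simp: Pi_iff subgroup.m_closed[OF P])
    also have "\<dots> = \<phi> g \<otimes>\<^bsub>?A\<^esub> finprod ?A (\<lambda>C. r (rep (C #> g) \<otimes> h)) (rcosets P)"
      unfolding \<phi>_def using r_Pi[OF g] shift by (intro A.finprod_multf) auto
    also have "finprod ?A (\<lambda>C. r (rep (C #> g) \<otimes> h)) (rcosets P)
        = finprod ?A (\<lambda>C. r (rep C \<otimes> h)) ((\<lambda>C. C #> g) ` (rcosets P))"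
      using perm[OF g] r_Pi[OF h] by (intro A.finprod_reindex[symmetric]) (auto simp: bij_betw_def)
    also have "\<dots> = \<phi> h" using perm[OF g] by (simp add: \<phi>_def bij_betw_def)
    finally show "\<phi> (g \<otimes> h) = \<phi> g \<otimes>\<^bsub>?A\<^esub> \<phi> h" .
  qed
  moreover have "\<phi> z = z [^] card (rcosets P)" if z: "z \<in> P" for z
  proof -
    have zc: "z \<in> carrier G" using z P subgroup.mem_carrier by metis
    \<comment> \<open>As \<open>z\<close> is central it moves to the left and out of
      \<open>r\<close>, while \<open>r (rep C)\<close> is trivial; the product defining
      \<open>\<phi> z\<close> is therefore constant.\<close>
    have "r (rep C \<otimes> z) = z" if C: "C \<in> rcosets P" for C
    proof -
      have c: "rep C \<in> carrier G" using rep_carrier C by simp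
      have "r (rep C \<otimes> z) = z \<otimes> r (rep C)"
        using central[OF z c] r_mult[OF z c] by simp
      moreover have "s (rep C) = rep C" using rep_carrier[OF C] by (simp add: s_def)
      ultimately show ?thesis using c zc by (simp add: r_def)
    qed
    then have "\<phi> z = finprod ?A (\<lambda>C. z) (rcosets P)"
      unfolding \<phi>_def using z by (intro A.finprod_cong') auto
    also have "\<dots> = z [^]\<^bsub>?A\<^esub> card (rcosets P)" using z by (intro A.finprod_const) simp
    finally show ?thesis by (simp flip: nat_pow_consistent)
  qed
  ultimately show thesis using that by blast
qed

text \<open>Pair the transfer with the quotient map. A kernel element lies in \<open>P\<close>,
  where the transfer is the power to the index; this exponent is coprime to the order of
  \<open>P\<close>, so the kernel is trivial. Equal cardinalities then give surjectivity.\<close>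

lemma (in group) central_coprime_subgroup_factor:
  assumes fin: "finite (carrier G)" and P: "subgroup P G"
    and central: "\<And>z g. z \<in> P \<Longrightarrow> g \<in> carrier G \<Longrightarrow> z \<otimes> g = g \<otimes> z"
    and cop: "coprime (card P) (card (rcosets P))"
  shows "G \<cong> G\<lparr>carrier := P\<rparr> \<times>\<times> (G Mod P)"
proof -
  let ?A = "G\<lparr>carrier := P\<rparr>"
  interpret N: normal P G by (rule central_imp_normal[OF P central])
  interpret A: group ?A using P by (rule subgroup_imp_group)
  interpret Q: group "G Mod P" by (rule N.factorgroup_is_group)
  interpret AQ: group "?A \<times>\<times> (G Mod P)" by (intro DirProd_group A.group_axioms Q.group_axioms)
  obtain \<phi> where \<phi>: "\<phi> \<in> hom G ?A" and \<phi>P: "\<And>z. z \<in> P \<Longrightarrow> \<phi> z = z [^] card (rcosets P)"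
    using transfer_central[OF P central] by blast
  let ?f = "\<lambda>g. (\<phi> g, P #> g)"
  have f: "?f \<in> hom G (?A \<times>\<times> (G Mod P))"
    using \<phi> N.r_coset_hom_Mod by (simp add: hom_pairwise o_def)
  interpret f: group_hom G "?A \<times>\<times> (G Mod P)" ?f
    by unfold_locales (rule f)
  have inj: "inj_on ?f (carrier G)"
    unfolding f.inj_on_one_iff
  proof (intro allI impI)
    fix g assume g: "g \<in> carrier G" and "?f g = \<one>\<^bsub>?A \<times>\<times> (G Mod P)\<^esub>"
    then have g1: "\<phi> g = \<one>" and "P #> g = P" by simp_all
    then have gP: "g \<in> P" using rcos_self[OF g P] by simp
    then have "g [^] card (rcosets P) = \<one>" using \<phi>P g1 by simp
    moreover have "g [^] card P = \<one>"
      using A.pow_order_eq_1[of g] gP by (simp add: order_def flip: nat_pow_consistent)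
    ultimately show "g = \<one>"
      using mem_subgroup_if_coprime_powers_mem[OF triv_subgroup g _ _ cop] by simp
  qed
  have "finite P" using subgroup.subset[OF P] fin by (rule finite_subset)
  then have finA: "finite (carrier (?A \<times>\<times> (G Mod P)))"
    using fin by (simp add: carrier_FactGroup)
  have "card (?f ` carrier G) = card (carrier (?A \<times>\<times> (G Mod P)))"
    using card_image[OF inj] lagrange[OF P]
    by (simp add: order_def FactGroup_def card_cartesian_product mult.commute)
  then have "?f ` carrier G = carrier (?A \<times>\<times> (G Mod P))"
    using f.hom_closed by (intro card_subset_eq[OF finA]) auto
  then have "?f \<in> iso G (?A \<times>\<times> (G Mod P))"
    using f inj by (simp add: iso_def bij_betw_def)
  then show ?thesis by (rule is_isoI)
qed

section \<open>Centrality of the Sylow subgroup for a large prime\<close>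

text \<open>This is the centralizer of \<open>g\<close>. As a subgroup, it lets commutation be
  checked on a generator or on two coprime powers.\<close>

lemma (in group) subgroup_commuting:
  assumes g: "g \<in> carrier G"
  shows "subgroup {z \<in> carrier G. z \<otimes> g = g \<otimes> z} G"
proof
  fix x y assume "x \<in> {z \<in> carrier G. z \<otimes> g = g \<otimes> z}" "y \<in> {z \<in> carrier G. z \<otimes> g = g \<otimes> z}"
  then show "x \<otimes> y \<in> {z \<in> carrier G. z \<otimes> g = g \<otimes> z}"
    using g by auto (metis m_assoc)
next
  fix x assume "x \<in> {z \<in> carrier G. z \<otimes> g = g \<otimes> z}"
  then show "inv x \<in> {z \<in> carrier G. z \<otimes> g = g \<otimes> z}"
    using g by auto (metis inv_solve_left inv_solve_right m_assoc inv_closed m_closed)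
qed (use g in auto)

lemma (in group) generate_singleton_pow_eq_one:
  fixes m :: nat
  assumes y: "y \<in> carrier G" and m: "y [^] m = \<one>" and c: "c \<in> generate G {y}"
  shows "c [^] m = \<one>"
proof -
  obtain k :: int where k: "c = y [^] k" using c generate_pow[OF y] by auto
  have "c [^] m = y [^] (int m * k)"
    using y k by (simp add: int_pow_pow mult.commute flip: int_pow_int)
  also have "\<dots> = (y [^] m) [^] k" using y by (simp add: int_pow_pow flip: int_pow_int)
  finally show ?thesis using m by simp
qed

lemma (in group) conj_nat_pow:
  fixes k :: nat
  assumes "g \<in> carrier G" "y \<in> carrier G"
  shows "(g \<otimes> y \<otimes> inv g) [^] k = g \<otimes> y [^] k \<otimes> inv g"
proof (induction k)
  case 0
  then show ?case using assms by simp
next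
  case (Suc k)
  have "inv g \<otimes> (g \<otimes> (y \<otimes> inv g)) = y \<otimes> inv g"
    using assms by (simp flip: m_assoc)
  with Suc show ?case using assms by (simp add: m_assoc)
qed

lemma (in group) eq_one_if_coprime_powers:
  fixes a b :: nat
  assumes "c \<in> carrier G" "c [^] a = \<one>" "c [^] b = \<one>" "coprime a b"
  shows "c = \<one>"
  using mem_subgroup_if_coprime_powers_mem[OF triv_subgroup assms(1) _ _ assms(4)] assms by simp

text \<open>\<open>y\<close> normalizes the cyclic Sylow subgroup, whose index in its normalizer is
  prime to \<open>p\<close>. Both the power of \<open>y\<close> to this index and its
  \<open>p ^ a\<close>-th power lie in the subgroup, hence so does \<open>y\<close>.\<close>

lemma (in group) p_element_in_sylow:
  assumes fin: "finite (carrier G)" and p: "Factorial_Ring.prime p"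
    and less: "card_cyclic_subgroups G < p"
    and ord: "order G = p ^ a * m" and m: "\<not> p dvd m"
    and x: "x \<in> carrier G" and card: "card (generate G {x}) = p ^ a"
    and y: "y \<in> carrier G" and yp: "y [^] (p ^ a) = \<one>"
  shows "y \<in> generate G {x}"
proof -
  let ?P = "generate G {x}"
  let ?N = "normalizer G ?P"
  let ?GN = "G\<lparr>carrier := ?N\<rparr>"
  have P: "subgroup ?P G" using x by (simp add: generate_is_subgroup)
  have N: "subgroup ?N G" by (rule normalizer_imp_subgroup[OF subgroup.subset[OF P]])
  interpret N: group ?GN by (rule subgroup_imp_group[OF N])
  interpret PN: normal ?P ?GN by (rule subgroup_in_normalizer[OF P])
  have yN: "y \<in> ?N" by (rule p_element_normalizes_cyclic[OF fin p less y yp x])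
  let ?k = "card (rcosets\<^bsub>?GN\<^esub> ?P)"
  \<comment> \<open>Lagrange twice: cancelling \<open>p ^ a\<close> leaves
    \<open>?k dvd m\<close>.\<close>
  have "?k * p ^ a = card ?N"
    using N.lagrange[OF PN.subgroup_axioms] card by (simp add: order_def)
  also have "\<dots> dvd m * p ^ a"
    using card_subgroup_dvd[OF N subgroup_self subgroup.subset[OF N]] ord
    by (simp add: order_def mult.commute)
  finally have "?k dvd m" using prime_gt_0_nat[OF p] by simp
  then have "\<not> p dvd ?k" using m dvd_trans by blast
  then have cop: "coprime ?k (p ^ a)"
    using p by (metis coprime_commute coprime_power_right_iff prime_imp_coprime)
  have "finite (carrier ?GN)" using fin subgroup.subset[OF N] by (simp add: finite_subset)
  then have "y [^]\<^bsub>?GN\<^esub> ?k \<in> ?P" using PN.pow_index_mem yN by simp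
  then have "y [^] ?k \<in> ?P" by (simp flip: nat_pow_consistent)
  moreover have "y [^] (p ^ a) \<in> ?P" using yp subgroup.one_closed[OF P] by simp
  ultimately show ?thesis using mem_subgroup_if_coprime_powers_mem[OF P y _ _ cop] by simp
qed

text \<open>The Sylow subgroup is cyclic, so it is central once its generator \<open>x\<close>
  commutes with every \<open>g\<close>. Since \<open>m\<close> and \<open>p ^ a\<close> are coprime,
  it is enough to treat \<open>g [^] m\<close>, which is a \<open>p\<close>-element and so a power
  of \<open>x\<close>, and \<open>g [^] (p ^ a)\<close>.\<close>

lemma (in group) large_prime_central_sylow:
  assumes fin: "finite (carrier G)" and p: "Factorial_Ring.prime p"
    and less: "card_cyclic_subgroups G < p" and dvd: "p dvd order G"
  obtains x where "x \<in> carrier G" and "p dvd card (generate G {x})"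
    and "coprime (card (generate G {x})) (card (rcosets (generate G {x})))"
    and "\<And>z g. z \<in> generate G {x} \<Longrightarrow> g \<in> carrier G \<Longrightarrow> z \<otimes> g = g \<otimes> z"
proof -
  have ord0: "order G \<noteq> 0" using fin order_gt_0_iff_finite by simp
  define a where "a = multiplicity p (order G)"
  obtain m where ord: "order G = p ^ a * m" and m: "\<not> p dvd m"
    unfolding a_def using multiplicity_decompose'[of "order G" p] ord0 p not_prime_unit by metis
  have "a > 0" using dvd ord0 p by (simp add: a_def prime_multiplicity_gt_zero_iff)
  have m_cop: "coprime m (p ^ a)"
    using m p by (metis coprime_commute coprime_power_right_iff prime_imp_coprime)
  obtain P where P: "subgroup P G" "card P = p ^ a"
    using sylow_thm[OF p group_axioms ord fin] by blast
  obtain x where xP: "x \<in> P" "P = generate G {x}"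
    using p_subgroup_cyclic[OF fin p less P] by blast
  have x: "x \<in> carrier G" using xP(1) P(1) subgroup.mem_carrier by metis
  have card: "card (generate G {x}) = p ^ a" using P(2) xP(2) by simp
  have P: "subgroup (generate G {x}) G" using P(1) xP(2) by simp
  have xp: "x [^] (p ^ a) = \<one>" using generate_pow_card[OF x] card pow_ord_eq_1[OF x] by simp
  have comm_x: "x \<otimes> g = g \<otimes> x" if g: "g \<in> carrier G" for g
  proof -
    let ?C = "{z \<in> carrier G. z \<otimes> x = x \<otimes> z}"
    have C: "subgroup ?C G" by (rule subgroup_commuting[OF x])
    have g_ord: "g [^] (p ^ a * m) = \<one>" using pow_order_eq_1[OF g] ord by simp
    have "g [^] m \<in> generate G {x}"
      using g g_ord
      by (intro p_element_in_sylow[OF fin p less ord m x card]) (simp_all add: nat_pow_pow mult.commute)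
    then have gm: "g [^] m \<in> ?C"
      using generate_singleton_subset[OF C, of x] x by auto
    define y where "y = g [^] (p ^ a)"
    have y: "y \<in> carrier G" "y [^] m = \<one>" using g g_ord by (simp_all add: y_def nat_pow_pow)
    \<comment> \<open>The commutator lies in the subgroup generated by \<open>y\<close>, which
      \<open>x\<close> normalizes. It also lies in the one generated by \<open>x\<close>, which
      contains the \<open>p\<close>-element \<open>y \<otimes> inv x \<otimes> inv y\<close>. Hence
      its \<open>m\<close>-th and \<open>p ^ a\<close>-th powers are both trivial.\<close>
    define c where "c = x \<otimes> y \<otimes> inv x \<otimes> inv y"
    have c: "c \<in> carrier G" using x y by (simp add: c_def)
    have "x \<otimes> y \<otimes> inv x \<in> generate G {y}"
      by (rule p_element_conj_cyclic[OF fin p less x xp y(1)])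
    then have "c \<in> generate G {y}"
      unfolding c_def using y(1) by (meson generate.eng generate.inv insertI1)
    then have cm: "c [^] m = \<one>" by (rule generate_singleton_pow_eq_one[OF y])
    have "inv x [^] (p ^ a) = \<one>" using x xp by (simp add: nat_pow_inv)
    then have "(y \<otimes> inv x \<otimes> inv y) [^] (p ^ a) = \<one>" using x y(1) by (simp add: conj_nat_pow)
    then have "y \<otimes> inv x \<otimes> inv y \<in> generate G {x}"
      using x y by (intro p_element_in_sylow[OF fin p less ord m x card]) simp_all
    then have "x \<otimes> (y \<otimes> inv x \<otimes> inv y) \<in> generate G {x}"
      by (meson generate.eng generate.incl insertI1)
    then have "c \<in> generate G {x}" using x y by (simp add: c_def m_assoc)
    then have "c [^] (p ^ a) = \<one>" by (rule generate_singleton_pow_eq_one[OF x xp])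
    then have "c = \<one>" using eq_one_if_coprime_powers[OF c cm _ m_cop] by simp
    then have "x \<otimes> y = y \<otimes> x"
      using x y unfolding c_def by (metis inv_closed inv_inv inv_solve_right l_one m_closed)
    then have "g [^] (p ^ a) \<in> ?C" using y by (simp add: y_def)
    then show ?thesis
      using mem_subgroup_if_coprime_powers_mem[OF C g gm _ m_cop] by auto
  qed
  have central: "z \<otimes> g = g \<otimes> z" if z: "z \<in> generate G {x}" and g: "g \<in> carrier G" for z g
    using generate_singleton_subset[OF subgroup_commuting[OF g], of x] comm_x[OF g] x z by auto
  have "card (rcosets (generate G {x})) * p ^ a = m * p ^ a"
    using lagrange[OF P] card ord by (simp add: mult.commute)
  then have "card (rcosets (generate G {x})) = m" using prime_gt_0_nat[OF p] by simp
  then have "coprime (card (generate G {x})) (card (rcosets (generate G {x})))"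
    using card m_cop by (simp add: coprime_commute)
  moreover have "p dvd card (generate G {x})" using card \<open>a > 0\<close> by simp
  ultimately show thesis using that x central by blast
qed

section \<open>Bounding the group order\<close>

lemma finite_group_iso_nat_group:
  assumes "group G" "finite (carrier G)"
  shows "\<exists>K :: nat monoid. group K \<and> G \<cong> K"
proof -
  obtain f :: "_ \<Rightarrow> nat" where "inj_on f (carrier G)"
    using finite_imp_inj_to_nat_seg[OF assms(2)] by blast
  then show ?thesis
    using group.inj_imp_image_group_is_group[OF assms(1)] inj_imp_image_group_iso is_isoI by blast
qed

text \<open>A larger prime would split off a nontrivial cyclic Sylow subgroup. Both factors are
  transported to carriers in \<open>nat\<close>, as \<open>coprime_direct_factor\<close> and the
  family require.\<close>

lemma prime_le_num_cyclic_subgroups: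
  assumes G: "G \<in> finite_groups_without_cyclic_cdf" and p: "Factorial_Ring.prime p"
    and dvd: "p dvd order G"
  shows "p \<le> num_cyclic_subgroups G"
proof (rule ccontr)
  assume neg: "\<not> ?thesis"
  have "group G" and fin: "finite (carrier G)"
    using G by (auto simp: finite_groups_without_cyclic_cdf_def)
  interpret group G by fact
  have "card_cyclic_subgroups G < p" using neg num_cyclic_subgroups_eq[OF \<open>group G\<close>] by simp
  from large_prime_central_sylow[OF fin p this dvd] obtain x where x: "x \<in> carrier G"
    and pdvd: "p dvd card (generate G {x})"
    and cop: "coprime (card (generate G {x})) (card (rcosets\<^bsub>G\<^esub> (generate G {x})))"
    and central: "\<And>z g. z \<in> generate G {x} \<Longrightarrow> g \<in> carrier G \<Longrightarrow> z \<otimes>\<^bsub>G\<^esub> g = g \<otimes>\<^bsub>G\<^esub> z"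
    by blast
  let ?P = "generate G {x}"
  let ?A = "G\<lparr>carrier := ?P\<rparr>"
  have P: "subgroup ?P G" using x by (simp add: generate_is_subgroup)
  interpret A: group ?A by (rule subgroup_imp_group[OF P])
  interpret N: normal ?P G by (rule central_imp_normal[OF P central])
  interpret Q: group "G Mod ?P" by (rule N.factorgroup_is_group)
  have iso: "G \<cong> ?A \<times>\<times> (G Mod ?P)"
    by (rule central_coprime_subgroup_factor[OF fin P central cop])
  have "finite (carrier ?A)" using fin subgroup.subset[OF P] by (simp add: finite_subset)
  then obtain H :: "nat monoid" where H: "group H" "?A \<cong> H"
    using finite_group_iso_nat_group[OF A.group_axioms] by blast
  have "finite (carrier (G Mod ?P))" using fin by (simp add: carrier_FactGroup)
  then obtain K :: "nat monoid" where K: "group K" "G Mod ?P \<cong> K"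
    using finite_group_iso_nat_group[OF Q.group_axioms] by blast
  have "G \<cong> H \<times>\<times> K" using iso A.DirProd_iso_trans[OF H(2) K(2)] iso_trans by blast
  moreover have "order H = card ?P" "order K = card (rcosets\<^bsub>G\<^esub> ?P)"
    using iso_same_card[OF H(2)] iso_same_card[OF K(2)] by (simp_all add: order_def FactGroup_def)
  ultimately have "coprime_direct_factor H G"
    using H(1) K(1) cop by (auto simp: coprime_direct_factor_def)
  moreover have "cyclic_group ?A"
    using x cyclic_group_generated[of x] by (simp add: subgroup_generated_def)
  then have "cyclic_group H"
    using isomorphic_group_cyclicity[OF H(2) A.group_axioms H(1)] by simp
  moreover have "\<not> trivial_group H"
  proof
    assume "trivial_group H"
    then have "order H = 1" by (simp add: trivial_group_def order_def)
    then show False using \<open>order H = card ?P\<close> pdvd p not_prime_unit by simp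
  qed
  ultimately show False using G by (auto simp: finite_groups_without_cyclic_cdf_def)
qed

text \<open>The elements \<open>x [^] (p ^ i)\<close> for \<open>i \<le> k\<close> have the distinct
  orders \<open>ord x div p ^ i\<close>, so they generate \<open>k + 1\<close> different cyclic
  subgroups.\<close>

lemma (in group) prime_power_dvd_ord_less:
  assumes fin: "finite (carrier G)" and x: "x \<in> carrier G"
    and p: "Factorial_Ring.prime (p :: nat)" and dvd: "p ^ k dvd ord x"
  shows "k < card_cyclic_subgroups G"
proof -
  let ?f = "\<lambda>i. generate G {x [^] (p ^ i)}"
  have ord_pos: "ord x > 0" using ord_ge_1[OF fin x] by simp
  have card: "card (?f i) * p ^ i = ord x" if "i \<le> k" for i
  proof -
    have d: "p ^ i dvd ord x" using that dvd le_imp_power_dvd dvd_trans by blast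
    have "card (?f i) = ord (x [^] (p ^ i))" using x by (simp add: generate_pow_card)
    also have "\<dots> = ord x div p ^ i"
      using x d p ord_pow_gen[OF x, of "p ^ i"] by (simp add: prime_gt_0_nat gcd_nat.absorb1)
    finally show ?thesis using d by simp
  qed
  have "inj_on ?f {..k}"
  proof (rule inj_onI)
    fix i j assume ij: "i \<in> {..k}" "j \<in> {..k}" "?f i = ?f j"
    then have "card (?f i) * p ^ i = card (?f i) * p ^ j" "card (?f i) \<noteq> 0"
      using card[of i] card[of j] ord_pos by (auto intro: Nat.gr0I)
    then have "p ^ i = p ^ j" by simp
    then show "i = j" using prime_gt_1_nat[OF p] by (simp add: power_inject_exp)
  qed
  then have "Suc k = card (?f ` {..k})" by (simp add: card_image)
  also have "\<dots> \<le> card_cyclic_subgroups G"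
    unfolding card_cyclic_subgroups_def using fin x by (intro card_mono) auto
  finally show ?thesis by simp
qed

lemma order_le_if_num_cyclic_subgroups_le:
  assumes G: "G \<in> finite_groups_without_cyclic_cdf" and n: "num_cyclic_subgroups G \<le> n"
  shows "order G \<le> n * fact n ^ n"
proof -
  have "group G" and fin: "finite (carrier G)"
    using G by (auto simp: finite_groups_without_cyclic_cdf_def)
  interpret group G by fact
  have n': "card_cyclic_subgroups G \<le> n" using n num_cyclic_subgroups_eq[OF \<open>group G\<close>] by simp
  have "card (generate G {x}) \<le> fact n ^ n" if x: "x \<in> carrier G" for x
  proof -
    have ord_pos: "ord x \<noteq> 0" using ord_ge_1[OF fin x] by simp
    \<comment> \<open>Compared prime by prime: a prime divisor of \<open>ord x\<close> is at most
      \<open>n\<close>, so it divides \<open>fact n\<close>, and its multiplicity in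
      \<open>ord x\<close> is below \<open>n\<close>.\<close>
    have "ord x dvd fact n ^ n"
    proof (rule multiplicity_le_imp_dvd)
      fix p :: nat assume p: "Factorial_Ring.prime p"
      show "multiplicity p (ord x) \<le> multiplicity p (fact n ^ n)"
      proof (cases "p dvd ord x")
        case True
        then have "p dvd order G" using ord_dvd_group_order[OF x] dvd_trans by blast
        then have "p \<le> n" using prime_le_num_cyclic_subgroups[OF G p] n by simp
        then have "p dvd fact n" using p by (simp add: prime_dvd_fact_iff)
        then have "p ^ n dvd fact n ^ n" by (rule dvd_power_same)
        then have "n \<le> multiplicity p (fact n ^ n :: nat)"
          using p by (intro multiplicity_geI) auto
        moreover have "multiplicity p (ord x) < n"
          using prime_power_dvd_ord_less[OF fin x p multiplicity_dvd] n' by simp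
        ultimately show ?thesis by simp
      qed (simp add: not_dvd_imp_multiplicity_0)
    qed (rule ord_pos)
    then show ?thesis using generate_pow_card[OF x] by (simp add: dvd_imp_le)
  qed
  then have "order G \<le> card_cyclic_subgroups G * fact n ^ n"
    unfolding order_def by (rule card_cyclic_decomposition_le[OF fin subgroup_self])
  also have "\<dots> \<le> n * fact n ^ n" using n' by (rule mult_right_mono) simp
  finally show ?thesis .
qed

section \<open>Finitely many isomorphism classes of bounded order\<close>

text \<open>After numbering its elements, a group is determined up to isomorphism by its
  multiplication table, a set of triples of numbers below \<open>N\<close>. There are finitely many
  such sets, and one group is chosen for each table that occurs.\<close>

lemma finite_iso_representatives:
  fixes F :: "('a, 'b) monoid_scheme set"
  assumes fin: "\<And>G. G \<in> F \<Longrightarrow> finite (carrier G)" and le: "\<And>G. G \<in> F \<Longrightarrow> order G \<le> N"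
    and grp: "\<And>G. G \<in> F \<Longrightarrow> group G"
  shows "\<exists>S. finite S \<and> S \<subseteq> F \<and> (\<forall>G\<in>F. \<exists>H\<in>S. G \<cong> H)"
proof -
  define num where "num G = (SOME f. bij_betw f (carrier G) {..<order G})"
    for G :: "('a, 'b) monoid_scheme"
  have num: "bij_betw (num G) (carrier G) {..<order G}" if "G \<in> F" for G
    unfolding num_def using ex_bij_betw_finite_nat[OF fin[OF that]]
    by (intro someI_ex[of "\<lambda>f. bij_betw f (carrier G) {..<order G}"])
      (simp add: order_def atLeast0LessThan)
  define tab where "tab G = (\<lambda>(x, y). (num G x, num G y, num G (x \<otimes>\<^bsub>G\<^esub> y))) ` (carrier G \<times> carrier G)"
    for G
  have num_less: "num G x < N" if "G \<in> F" "x \<in> carrier G" for G x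
    using bij_betw_apply[OF num[OF that(1)] that(2)] le[OF that(1)] by simp
  have "tab ` F \<subseteq> Pow ({..<N} \<times> {..<N} \<times> {..<N})"
    using num_less monoid.m_closed[OF group.is_monoid[OF grp]] by (auto simp: tab_def)
  then have fin_tab: "finite (tab ` F)" by (rule finite_subset) simp
  have iso: "G \<cong> H" if G: "G \<in> F" and H: "H \<in> F" and eq: "tab G = tab H" for G H
  proof -
    interpret G: group G by (rule grp[OF G])
    interpret H: group H by (rule grp[OF H])
    \<comment> \<open>The table reveals which numbers are in use; the unit supplies a second factor
      for every element.\<close>
    have rng: "num K ` carrier K = fst ` tab K" if "K \<in> F" for K
      using grp[OF that] by (force simp: tab_def group.is_monoid monoid.one_closed)
    have inj: "inj_on (num G) (carrier G)" "inj_on (num H) (carrier H)"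
      using num G H by (auto simp: bij_betw_def)
    have rng_eq: "num G ` carrier G = num H ` carrier H" using rng G H eq by simp
    \<comment> \<open>\<open>h\<close> matches elements carrying the same number; equality of the
      tables makes it multiplicative.\<close>
    define h where "h x = inv_into (carrier H) (num H) (num G x)" for x
    have h: "h x \<in> carrier H" if "x \<in> carrier G" for x
      unfolding h_def using that rng_eq by (metis imageI inv_into_into)
    have "bij_betw h (carrier G) (carrier H)"
      using bij_betw_trans[OF inj_on_imp_bij_betw[OF inj(1)], of "inv_into (carrier H) (num H)" "carrier H"]
        bij_betw_inv_into[OF inj_on_imp_bij_betw[OF inj(2)]] rng_eq
      by (simp add: h_def[abs_def] o_def)
    moreover have "h (x \<otimes>\<^bsub>G\<^esub> y) = h x \<otimes>\<^bsub>H\<^esub> h y" if x: "x \<in> carrier G" and y: "y \<in> carrier G" for x y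
    proof -
      have "(num G x, num G y, num G (x \<otimes>\<^bsub>G\<^esub> y)) \<in> tab H"
        unfolding eq[symmetric] using x y by (force simp: tab_def)
      then obtain u v where "u \<in> carrier H" "v \<in> carrier H"
        and e: "num G x = num H u" "num G y = num H v" "num G (x \<otimes>\<^bsub>G\<^esub> y) = num H (u \<otimes>\<^bsub>H\<^esub> v)"
        by (auto simp: tab_def)
      then have "h x = u" "h y = v" "h (x \<otimes>\<^bsub>G\<^esub> y) = u \<otimes>\<^bsub>H\<^esub> v"
        using inj(2) by (simp_all add: h_def inv_into_f_f)
      then show ?thesis by simp
    qed
    ultimately have "h \<in> iso G H" using h by (simp add: iso_def hom_def)
    then show ?thesis by (rule is_isoI)
  qed
  let ?S = "inv_into F tab ` tab ` F"
  have "?S \<subseteq> F" by (auto intro: inv_into_into)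
  moreover have "G \<cong> inv_into F tab (tab G)" if "G \<in> F" for G
    using that by (intro iso) (auto intro: inv_into_into simp: f_inv_into_f)
  ultimately show ?thesis using fin_tab by (intro exI[of _ ?S]) auto
qed

theorem theorem1p4:
  shows "cyclic_bounded (finite_groups_without_cyclic_cdf :: 'a monoid set)"
  unfolding cyclic_bounded_def
proof (intro conjI allI)
  show "\<forall>G\<in>finite_groups_without_cyclic_cdf :: 'a monoid set. group G \<and> finite (carrier G)"
    by (simp add: finite_groups_without_cyclic_cdf_def)
  fix n
  define F where "F = {G \<in> finite_groups_without_cyclic_cdf :: 'a monoid set. num_cyclic_subgroups G \<le> n}"
  have "group G" "finite (carrier G)" "order G \<le> n * fact n ^ n" if "G \<in> F" for G
    using that order_le_if_num_cyclic_subgroups_le[of G n]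
    by (simp_all add: F_def finite_groups_without_cyclic_cdf_def)
  then obtain S where S: "finite S" "S \<subseteq> F" "\<And>G. G \<in> F \<Longrightarrow> \<exists>H\<in>S. G \<cong> H"
    using finite_iso_representatives[of F "n * fact n ^ n"] by metis
  then have "finite S \<and> S \<subseteq> F \<and>
      (\<forall>G\<in>finite_groups_without_cyclic_cdf :: 'a monoid set. num_cyclic_subgroups G \<le> n \<longrightarrow> (\<exists>H\<in>S. G \<cong> H))"
    by (simp add: F_def)
  then show "\<exists>S. finite S \<and>
      S \<subseteq> {G \<in> finite_groups_without_cyclic_cdf :: 'a monoid set. num_cyclic_subgroups G \<le> n} \<and>
      (\<forall>G\<in>finite_groups_without_cyclic_cdf :: 'a monoid set. num_cyclic_subgroups G \<le> n \<longrightarrow> (\<exists>H\<in>S. G \<cong> H))"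
    unfolding F_def by (rule exI)
qed

end
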